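(* Let $b, c$ be integers satisfying $-3 \le b \le 0$ and $c \ge -b+1$. Then $\mathbb{Q}(\alpha) \neq \mathbb{Q}(\beta)$ holds for all $\alpha, \beta \in I_{b,c}^{3,ntr}$ with $\alpha \neq \beta$.
   Context: For integers $m, n$ satisfying $m^2-3n \le 0$ and $m+n \ge 1$, define $$I_{m,n}^{3,ntr} := \{\alpha \in (0,1) \mid \alpha^3+m\alpha^2+n\alpha+d=0 \text{ for some } d \in \mathbb{Z},\ -(m+n) \le d \le -1\}.$$ $\mathbb{Q}(\alpha)$ denotes the subfield of $\mathbb{C}$ generated by $\alpha$. *)

theory Defs
  imports Complex_Main "HOL-Algebra.Algebraic_Closure_Type" "HOL-Algebra.Generated_Fields"
begin

text \<open>
  The definition is total in \<open>m\<close> and \<open>n\<close>, but it is only meant to be used for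
  \<open>m\<^sup>2 - 3 * n \<le> 0\<close> and \<open>m + n \<ge> 1\<close>. These conditions make the cubic strictly
  increasing on the real line, so that each admissible \<open>d\<close> contributes at most one element.
\<close>

definition I3ntr :: "int \<Rightarrow> int \<Rightarrow> real set" where
  "I3ntr m n = {\<alpha>. 0 < \<alpha> \<and> \<alpha> < 1 \<and>
     (\<exists>d::int. - (m + n) \<le> d \<and> d \<le> - 1 \<and>
        \<alpha> ^ 3 + of_int m * \<alpha> ^ 2 + of_int n * \<alpha> + of_int d = 0)}"

lemma I3ntr_parameters:
  fixes b c :: int
  assumes "- 3 \<le> b" "b \<le> 0" "c \<ge> - b + 1"
  shows "b ^ 2 - 3 * c \<le> 0" "b + c \<ge> 1"
proof -
  have "b * (b + 3) \<le> 0"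
    using assms by (intro mult_nonpos_nonneg) auto
  then show "b ^ 2 - 3 * c \<le> 0"
    using assms by (simp add: power2_eq_square algebra_simps)
  show "b + c \<ge> 1"
    using assms by simp
qed

text \<open>
  The record \<open>ring_of_type_algebra\<close>, taken at type \<open>complex\<close>, is the field of complex numbers
  with its usual operations and the whole type as carrier.
\<close>

definition Q_adjoin :: "complex \<Rightarrow> complex set" where
  "Q_adjoin z = generate_field (ring_of_type_algebra :: complex ring) {z}"

end

theory Submission
  imports Defs
begin

text \<open>
  Let \<open>\<alpha>\<close>, \<open>\<beta>\<close> be distinct elements generating the same cubic field and let \<open>T\<close> be the
  trace of \<open>\<alpha>\<beta>\<close>. Shifting both by \<open>b / 3\<close> gives roots of \<open>x\<^sup>3 + p x + q\<close> and \<open>x\<^sup>3 + p x + q'\<close> with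
  the same \<open>p\<close>; there \<open>T\<close> satisfies a quadratic equation over \<open>\<real>\<close> with coefficients in terms of
  \<open>\<alpha>\<close>, \<open>\<beta>\<close>, and hence a monic sextic whose unshifted form has integer coefficients, so the
  unshifted trace is an integer. As \<open>\<bar>\<alpha> - \<beta>\<bar> < 1\<close>, the smaller root of the quadratic lies strictly
  between \<open>- 2p - 1\<close> and \<open>- 2p\<close> and is excluded by integrality; the larger root forces
  \<open>k = T - 2p\<close> to be \<open>1\<close>, \<open>2\<close> (for \<open>b = 0\<close>) or \<open>1 / 3\<close> (for \<open>b = - 1\<close>). The sextic then reads
  \<open>k (3p + k)\<^sup>2 ((4p + k) (p + k)\<^sup>2 - 27 q q') = 27 p\<^sup>3 (q + q')\<^sup>2\<close>,
  so \<open>3p + k\<close> essentially divides \<open>q + q'\<close>, which is too small for this. The substitution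
  \<open>x \<mapsto> 1 - x\<close> exchanges \<open>b\<close> and \<open>- 3 - b\<close>.
\<close>

section \<open>Integrality of rational roots\<close>

lemma monic_cubic_rational_root_int:
  fixes a :: real and b c d :: int
  assumes "a ^ 3 + of_int b * a ^ 2 + of_int c * a + of_int d = 0" and "a \<in> \<rat>"
  shows "a \<in> \<int>"
proof -
  have "poly (map_poly of_int [:d, c, b, 1:]) a = 0"
    using assms(1) by (simp add: map_poly_pCons power2_eq_square power3_eq_cube algebra_simps)
  then have "algebraic_int a"
    unfolding algebraic_int_altdef_ipoly by (intro exI[of _ "[:d, c, b, 1:]"]) auto
  then show ?thesis
    using assms(2) by (rule rational_algebraic_int_is_int)
qed

lemma monic_sextic_rational_root_int:
  fixes t :: real and c0 c1 c2 c3 c4 c5 :: int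
  assumes "t ^ 6 + of_int c5 * t ^ 5 + of_int c4 * t ^ 4 + of_int c3 * t ^ 3
             + of_int c2 * t ^ 2 + of_int c1 * t + of_int c0 = 0" and "t \<in> \<rat>"
  shows "t \<in> \<int>"
proof -
  have "poly (map_poly of_int [:c0, c1, c2, c3, c4, c5, 1:]) t = 0"
    using assms(1) by (simp add: map_poly_pCons algebra_simps eval_nat_numeral)
  then have "algebraic_int t"
    unfolding algebraic_int_altdef_ipoly
    by (intro exI[of _ "[:c0, c1, c2, c3, c4, c5, 1:]"]) auto
  then show ?thesis
    using assms(2) by (rule rational_algebraic_int_is_int)
qed

section \<open>Arithmetic in the rational span of 1, a, a^2\<close>

text \<open>For a root \<open>a\<close> of a rational cubic this is the field Q(a) as a set of
  reals. The cubic may be reducible, so coefficients need not be unique.\<close>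

definition rat_span :: "real \<Rightarrow> real set" where
  "rat_span a = {x + y * a + z * a ^ 2 | x y z. x \<in> \<rat> \<and> y \<in> \<rat> \<and> z \<in> \<rat>}"

lemma rat_spanI:
  "\<lbrakk>x \<in> \<rat>; y \<in> \<rat>; z \<in> \<rat>; u = x + y * a + z * a ^ 2\<rbrakk> \<Longrightarrow> u \<in> rat_span a"
  unfolding rat_span_def by blast

lemma rat_spanE:
  assumes "u \<in> rat_span a"
  obtains x y z where "x \<in> \<rat>" "y \<in> \<rat>" "z \<in> \<rat>" "u = x + y * a + z * a ^ 2"
  using assms unfolding rat_span_def by blast

lemma rat_span_Rats: "x \<in> \<rat> \<Longrightarrow> x \<in> rat_span a"
  by (rule rat_spanI[of x 0 0]) auto

lemma rat_span_add:
  assumes "u \<in> rat_span a" "v \<in> rat_span a"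
  shows "u + v \<in> rat_span a"
proof -
  obtain x y z where u: "x \<in> \<rat>" "y \<in> \<rat>" "z \<in> \<rat>" "u = x + y * a + z * a ^ 2"
    using assms(1) by (rule rat_spanE)
  obtain x' y' z' where v: "x' \<in> \<rat>" "y' \<in> \<rat>" "z' \<in> \<rat>" "v = x' + y' * a + z' * a ^ 2"
    using assms(2) by (rule rat_spanE)
  show ?thesis
    by (rule rat_spanI[of "x + x'" "y + y'" "z + z'"]) (use u v in \<open>auto simp: algebra_simps\<close>)
qed

lemma rat_span_mult_Rats:
  assumes "k \<in> \<rat>" "u \<in> rat_span a"
  shows "k * u \<in> rat_span a"
proof -
  obtain x y z where u: "x \<in> \<rat>" "y \<in> \<rat>" "z \<in> \<rat>" "u = x + y * a + z * a ^ 2"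
    using assms(2) by (rule rat_spanE)
  show ?thesis
    by (rule rat_spanI[of "k * x" "k * y" "k * z"]) (use u assms(1) in \<open>auto simp: algebra_simps\<close>)
qed

lemma rat_span_uminus: "u \<in> rat_span a \<Longrightarrow> - u \<in> rat_span a"
  using rat_span_mult_Rats[of "- 1" u a] by simp

lemma rat_span_affine:
  assumes "u \<in> rat_span a" "s \<in> \<rat>" "t \<in> \<rat>" "s \<noteq> 0"
  shows "u \<in> rat_span (s * a + t)"
proof -
  obtain x y z where u: "x \<in> \<rat>" "y \<in> \<rat>" "z \<in> \<rat>" "u = x + y * a + z * a ^ 2"
    using assms(1) by (rule rat_spanE)
  define k where "k = 1 / s"
  have a: "k * ((s * a + t) - t) = a" using assms(4) by (simp add: k_def)
  have k: "k \<in> \<rat>" using assms(2) by (simp add: k_def)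
  have "u = x + y * (k * (A - t)) + z * (k * (A - t)) ^ 2" if "A = s * a + t" for A
    by (simp only: u(4) that a)
  then show ?thesis
    by (intro rat_spanI[of "x - y * k * t + z * k ^ 2 * t ^ 2" "y * k - 2 * z * k ^ 2 * t" "z * k ^ 2"])
       (use u(1-3) k assms(3) in \<open>auto simp: algebra_simps power2_eq_square\<close>)
qed

locale depressed_cubic =
  fixes a p q :: real
  assumes rat: "p \<in> \<rat>" "q \<in> \<rat>" and root: "a ^ 3 + p * a + q = 0"
begin

lemma rat_span_mult:
  assumes "u \<in> rat_span a" "v \<in> rat_span a"
  shows "u * v \<in> rat_span a"
proof -
  obtain x y z where u: "x \<in> \<rat>" "y \<in> \<rat>" "z \<in> \<rat>" "u = x + y * a + z * a ^ 2"
    using assms(1) by (rule rat_spanE)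
  obtain x' y' z' where v: "x' \<in> \<rat>" "y' \<in> \<rat>" "z' \<in> \<rat>" "v = x' + y' * a + z' * a ^ 2"
    using assms(2) by (rule rat_spanE)
  show ?thesis
  proof (rule rat_spanI)
    \<comment> \<open>Expand and reduce with a^3 = - p a - q and a^4 = - p a^2 - q a.\<close>
    show "u * v = (x * x' - q * (y * z' + z * y'))
      + (x * y' + y * x' - p * (y * z' + z * y') - q * z * z') * a
      + (x * z' + y * y' + z * x' - p * z * z') * a ^ 2"
      using u(4) v(4) root by Groebner_Basis.algebra
  qed (use u v rat in auto)
qed

text \<open>Cayley--Hamilton for multiplication by \<open>x + y a + z a\<^sup>2\<close>.\<close>

lemma char_poly:
  assumes "u = x + y * a + z * a ^ 2"
    and "t = 3 * x - 2 * p * z"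
    and "s = 3 * x ^ 2 - 4 * p * x * z + p * y ^ 2 + p ^ 2 * z ^ 2 + 3 * q * y * z"
    and "n = x ^ 3 - q * y ^ 3 + q ^ 2 * z ^ 3 + p * x * y ^ 2 + p ^ 2 * x * z ^ 2
           - 2 * p * x ^ 2 * z + 3 * q * x * y * z - p * q * y * z ^ 2"
  shows "u ^ 3 - t * u ^ 2 + s * u - n = 0"
  using assms root by Groebner_Basis.algebra

text \<open>Cayley-Hamilton gives u (u^2 - t u + s) = n, which exhibits the inverse if n is nonzero.
  As the cubic may be reducible, n = 0 can occur with u nonzero; then u cancels and the argument
  repeats with s, and after that with t.\<close>

lemma rat_span_inverse:
  assumes "u \<in> rat_span a"
  shows "inverse u \<in> rat_span a"
proof (cases "u = 0")
  case True
  then show ?thesis by (simp add: rat_span_Rats)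
next
  case u0: False
  obtain x y z where u: "x \<in> \<rat>" "y \<in> \<rat>" "z \<in> \<rat>" "u = x + y * a + z * a ^ 2"
    using assms by (rule rat_spanE)
  define t where "t = 3 * x - 2 * p * z"
  define s where "s = 3 * x ^ 2 - 4 * p * x * z + p * y ^ 2 + p ^ 2 * z ^ 2 + 3 * q * y * z"
  define n where "n = x ^ 3 - q * y ^ 3 + q ^ 2 * z ^ 3 + p * x * y ^ 2 + p ^ 2 * x * z ^ 2
           - 2 * p * x ^ 2 * z + 3 * q * x * y * z - p * q * y * z ^ 2"
  have r: "t \<in> \<rat>" "s \<in> \<rat>" "n \<in> \<rat>"
    using u rat by (auto simp: t_def s_def n_def)
  have ch: "u ^ 3 - t * u ^ 2 + s * u - n = 0"
    using char_poly[OF u(4) t_def s_def n_def] .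
  have uu: "u ^ 2 \<in> rat_span a"
    using rat_span_mult[OF assms assms] by (simp add: power2_eq_square)
  have inv: "inverse u = (1 / k) * v" if "u * v = k" "k \<noteq> 0" for v k
    by (rule inverse_unique) (use that in auto)
  show ?thesis
  proof (cases "n = 0")
    case False
    have "u * (u ^ 2 + ((- t) * u + s)) = n"
      using ch by (simp add: power2_eq_square power3_eq_cube algebra_simps)
    then have "inverse u = (1 / n) * (u ^ 2 + ((- t) * u + s))"
      using False by (rule inv)
    also have "\<dots> \<in> rat_span a"
      by (intro rat_span_mult_Rats rat_span_add rat_span_Rats uu assms) (use r in auto)
    finally show ?thesis .
  next
    case True
    have ch2: "u ^ 2 - t * u + s = 0"
    proof -
      have "u * (u ^ 2 - t * u + s) = 0" using ch True by Groebner_Basis.algebra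
      then show ?thesis using u0 by simp
    qed
    show ?thesis
    proof (cases "s = 0")
      case False
      have "u * (t + (- 1) * u) = s"
        using ch2 by (simp add: power2_eq_square algebra_simps)
      then have "inverse u = (1 / s) * (t + (- 1) * u)"
        using False by (rule inv)
      also have "\<dots> \<in> rat_span a"
        by (intro rat_span_mult_Rats rat_span_add rat_span_Rats assms) (use r in auto)
      finally show ?thesis .
    next
      case True
      have "u * (u - t) = 0" using ch2 True by Groebner_Basis.algebra
      then have "u = t" using u0 by simp
      then show ?thesis using r by (auto intro: rat_span_Rats)
    qed
  qed
qed

end

section \<open>From generated fields to the rational span\<close>

lemma type_algebra_simps:
  "carrier (ring_of_type_algebra :: complex ring) = UNIV"
  "\<one>\<^bsub>(ring_of_type_algebra :: complex ring)\<^esub> = 1"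
  "\<zero>\<^bsub>(ring_of_type_algebra :: complex ring)\<^esub> = 0"
  "x \<oplus>\<^bsub>(ring_of_type_algebra :: complex ring)\<^esub> y = x + y"
  "x \<otimes>\<^bsub>(ring_of_type_algebra :: complex ring)\<^esub> y = x * y"
  by (simp_all add: ring_of_type_algebra_def)

lemma type_algebra_a_inv: "\<ominus>\<^bsub>(ring_of_type_algebra :: complex ring)\<^esub> x = - x"
proof -
  interpret ring "ring_of_type_algebra :: complex ring"
    by (rule ring_from_type_algebra)
  show ?thesis
    by (rule minus_equality) (simp_all add: type_algebra_simps)
qed

lemma type_algebra_m_inv:
  "x \<noteq> 0 \<Longrightarrow> inv\<^bsub>(ring_of_type_algebra :: complex ring)\<^esub> x = inverse x"
proof -
  assume "x \<noteq> 0"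
  interpret cring "ring_of_type_algebra :: complex ring"
    by (rule cring_from_type_algebra)
  show ?thesis
    by (rule comm_inv_char) (use \<open>x \<noteq> 0\<close> in \<open>simp_all add: type_algebra_simps\<close>)
qed

text \<open>The generator \<open>g\<close> is kept apart from \<open>a\<close>, so that an
  undepressed root can be adjoined while the arithmetic runs over its shift.\<close>

lemma (in depressed_cubic) Q_adjoin_subset_rat_span:
  assumes "g \<in> rat_span a" "w \<in> Q_adjoin (complex_of_real g)"
  shows "w \<in> complex_of_real ` rat_span a"
  using assms(2) unfolding Q_adjoin_def
proof (induction rule: generate_field.induct)
  case one
  then show ?case
    by (auto simp: type_algebra_simps intro!: image_eqI[of _ _ 1] rat_span_Rats)
next
  case (incl h)
  then show ?case using assms(1) by simp
next
  case (a_inv h)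
  then show ?case
    by (auto simp: type_algebra_a_inv intro!: image_eqI[of _ _ "- _"] rat_span_uminus)
next
  case (m_inv h)
  then show ?case
    by (auto simp: type_algebra_simps type_algebra_m_inv
        intro!: image_eqI[of _ _ "inverse _"] rat_span_inverse)
next
  case (eng_add h1 h2)
  then show ?case
    by (auto simp: type_algebra_simps intro!: image_eqI[of _ _ "_ + _"] rat_span_add)
next
  case (eng_mult h1 h2)
  then show ?case
    by (auto simp: type_algebra_simps intro!: image_eqI[of _ _ "_ * _"] rat_span_mult)
qed

section \<open>Linear independence and the trace quadratic\<close>

lemma cubic_mono_root_unique:
  fixes p q x y :: real
  assumes "p > 0" "x ^ 3 + p * x + q = 0" "y ^ 3 + p * y + q = 0"
  shows "x = y"
proof -
  have "(x - y) * (x ^ 2 + x * y + y ^ 2 + p) = 0"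
    using assms(2,3) by Groebner_Basis.algebra
  moreover have "x ^ 2 + x * y + y ^ 2 + p \<noteq> 0"
  proof
    assume "x ^ 2 + x * y + y ^ 2 + p = 0"
    then have "(2 * x + y) ^ 2 + 3 * y ^ 2 + 4 * p = 0" by Groebner_Basis.algebra
    moreover have "(2 * x + y) ^ 2 \<ge> 0" "y ^ 2 \<ge> 0" by simp_all
    ultimately show False using assms(1) by linarith
  qed
  ultimately have "x - y = 0" by simp
  then show ?thesis by simp
qed

locale irrational_cubic = depressed_cubic +
  assumes pos: "p > 0" and irrational: "a \<notin> \<rat>"
begin

lemma independent:
  assumes r: "r0 \<in> \<rat>" "r1 \<in> \<rat>" "r2 \<in> \<rat>" and eq: "r0 + r1 * a + r2 * a ^ 2 = 0"
  shows "r0 = 0" "r1 = 0" "r2 = 0"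
proof -
  have lin: "s1 = 0" if "s0 \<in> \<rat>" "s1 \<in> \<rat>" "s0 + s1 * a = 0" for s0 s1
  proof (rule ccontr)
    assume "s1 \<noteq> 0"
    then have "a = - s0 / s1" using that(3) by (simp add: field_simps)
    then show False using that irrational by auto
  qed
  show "r2 = 0"
  proof (rule ccontr)
    assume n: "r2 \<noteq> 0"
    define s t where "s = - r1 / r2" and "t = - r0 / r2"
    have st: "s \<in> \<rat>" "t \<in> \<rat>" using r by (auto simp: s_def t_def)
    have sq: "a ^ 2 = s * a + t"
      using eq n by (simp add: s_def t_def field_simps)
    have "(s * t + q) + (s ^ 2 + t + p) * a = 0"
      using sq root by Groebner_Basis.algebra
    then have 1: "s ^ 2 + t + p = 0" and 2: "s * t + q = 0"
      using lin[of "s * t + q" "s ^ 2 + t + p"] st rat by auto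
    \<comment> \<open>The cubic is now (x^2 - s x - t)(x + s), so - s is a rational real root, and
      the real root is unique.\<close>
    have "(- s) ^ 3 + p * (- s) + q = 0"
      using 1 2 by Groebner_Basis.algebra
    then have "- s = a"
      using root pos cubic_mono_root_unique by blast
    then show False using st irrational by auto
  qed
  then show "r1 = 0" using lin[of r0 r1] eq r by simp
  then show "r0 = 0" using eq \<open>r2 = 0\<close> by simp
qed

text \<open>
  \<open>T\<close> is the trace of \<open>a * b\<close>. If \<open>a'\<close>, \<open>b'\<close> are the images under a complex embedding, then
  \<open>T = a * b + 2 * Re (a' * b')\<close>, and \<open>a'\<close>, \<open>b'\<close> are determined by \<open>a\<close>, \<open>b\<close> up to conjugation:
  the two roots of the quadratic are the two relative signs of the imaginary parts.
\<close>

lemma trace_quadratic: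
  assumes b: "irrational_cubic b p q'" and span: "b \<in> rat_span a"
  obtains T where "T \<in> \<rat>" "T ^ 2 - 3 * a * b * T - 3 * p * (a ^ 2 + b ^ 2) - 4 * p ^ 2 = 0"
proof -
  interpret B: irrational_cubic b p q' by (rule b)
  obtain x y z where u: "x \<in> \<rat>" "y \<in> \<rat>" "z \<in> \<rat>" "b = x + y * a + z * a ^ 2"
    using span by (rule rat_spanE)
  define t where "t = 3 * x - 2 * p * z"
  define s where "s = 3 * x ^ 2 - 4 * p * x * z + p * y ^ 2 + p ^ 2 * z ^ 2 + 3 * q * y * z"
  define n where "n = x ^ 3 - q * y ^ 3 + q ^ 2 * z ^ 3 + p * x * y ^ 2 + p ^ 2 * x * z ^ 2
           - 2 * p * x ^ 2 * z + 3 * q * x * y * z - p * q * y * z ^ 2"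
  have r: "t \<in> \<rat>" "s \<in> \<rat>" "n \<in> \<rat>"
    using u rat by (auto simp: t_def s_def n_def)
  have ch: "b ^ 3 - t * b ^ 2 + s * b - n = 0"
    using char_poly[OF u(4) t_def s_def n_def] .
  \<comment> \<open>Subtracting the cubic of \<open>b\<close> from its characteristic polynomial
    leaves a rational relation of degree at most 2, so the coefficients agree.\<close>
  have rel: "(n + q') + (p - s) * b + t * b ^ 2 = 0"
    using ch B.root by Groebner_Basis.algebra
  have t: "t = 0" and s: "s = p"
    using B.independent[OF _ _ _ rel] r B.rat by auto
  \<comment> \<open>The trace of a b = x a + y a^2 + z a^3: the traces of a, a^2, a^3 are 0, - 2p, -
    3q.\<close>
  define T where "T = - 2 * p * y - 3 * q * z"
  have "T \<in> \<rat>" using u rat by (auto simp: T_def)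
  moreover have "T ^ 2 - 3 * a * b * T - 3 * p * (a ^ 2 + b ^ 2) - 4 * p ^ 2 = 0"
  proof -
    define k where "k = z / 3"
    have z: "z = 3 * k" by (simp add: k_def)
    have x: "x = 2 * p * k" using t by (simp add: t_def z)
    have b: "b = y * a + k * (3 * a ^ 2 + 2 * p)"
      using u(4) unfolding x z by (simp add: algebra_simps)
    have p: "p = p * y ^ 2 + 9 * q * y * k - 3 * p ^ 2 * k ^ 2"
      using s unfolding s_def x z by (simp add: algebra_simps power2_eq_square)
    have q: "q = - p * a - a ^ 3" using root by simp
    \<comment> \<open>- m is the discriminant of the quadratic cofactor x^2 + a x + a^2 + p, and w
      is the ratio of the imaginary parts of b' and a'. Hence m w^2 is the analogue of m for
      \<open>b\<close>.\<close>
    define m w where "m = 3 * a ^ 2 + 4 * p" and "w = y - 3 * k * a"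
    have 1: "2 * T - 3 * a * b = - (m * w)"
      unfolding T_def b m_def w_def z q by Groebner_Basis.algebra
    have 2: "m * w ^ 2 = 3 * b ^ 2 + 4 * p"
    proof -
      have "m * w ^ 2 = 3 * b ^ 2 + 4 * (p * y ^ 2 + 9 * q * y * k - 3 * p ^ 2 * k ^ 2)"
        unfolding b m_def w_def q by Groebner_Basis.algebra
      then show ?thesis using p by simp
    qed
    have "(2 * T - 3 * a * b) ^ 2 = m * (m * w ^ 2)"
      unfolding 1 by Groebner_Basis.algebra
    then have "(2 * T - 3 * a * b) ^ 2 = (3 * a ^ 2 + 4 * p) * (3 * b ^ 2 + 4 * p)"
      unfolding 2 by (simp only: m_def)
    then show ?thesis by Groebner_Basis.algebra
  qed
  ultimately show thesis by (rule that)
qed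

end


section \<open>Sextic equation and size of the trace\<close>

text \<open>The six roots of the sextic are the sums of products that match the roots of one cubic
  with those of the other. The quadratic collects the two matchings that pair \<open>a\<close> with
  \<open>b\<close>; the quartic cofactor in the proof collects the other four.\<close>

lemma trace_sextic:
  fixes a b p q q' T :: real
  assumes "T ^ 2 - 3 * a * b * T - 3 * p * (a ^ 2 + b ^ 2) - 4 * p ^ 2 = 0"
    and "a ^ 3 + p * a + q = 0" and "b ^ 3 + p * b + q' = 0"
  shows "(T ^ 2 - 4 * p ^ 2) * (T ^ 2 - p ^ 2) ^ 2
           - 27 * p ^ 3 * (q ^ 2 + q' ^ 2) - 27 * q * q' * (T ^ 3 - 3 * p ^ 2 * T) = 0"
proof -
  have q: "q = - (a ^ 3 + p * a)" "q' = - (b ^ 3 + p * b)"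
    using assms(2,3) by linarith+
  have "(T ^ 2 - 4 * p ^ 2) * (T ^ 2 - p ^ 2) ^ 2
           - 27 * p ^ 3 * (q ^ 2 + q' ^ 2) - 27 * q * q' * (T ^ 3 - 3 * p ^ 2 * T)
     = (T ^ 2 - 3 * a * b * T - 3 * p * (a ^ 2 + b ^ 2) - 4 * p ^ 2)
       * (T ^ 4 + 3 * a * b * T ^ 3 + (9 * a ^ 2 * b ^ 2 + 3 * p * (a ^ 2 + b ^ 2) - 2 * p ^ 2) * T ^ 2
          - (21 * a * b * p ^ 2 + 9 * p * a * b ^ 3 + 9 * p * a ^ 3 * b) * T
          + (p ^ 4 + 6 * p ^ 3 * (a ^ 2 + b ^ 2) + 9 * p ^ 2 * (a ^ 4 + b ^ 4) - 9 * p ^ 2 * a ^ 2 * b ^ 2))"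
    unfolding q by Groebner_Basis.algebra
  then show ?thesis
    unfolding assms(1) by simp
qed

lemma trace_bounds:
  fixes a b p T :: real
  assumes h: "T ^ 2 - 3 * a * b * T - 3 * p * (a ^ 2 + b ^ 2) - 4 * p ^ 2 = 0"
    and p: "p > 0" and ne: "a \<noteq> b" and d1: "\<bar>a - b\<bar> < 1" and int: "T + 2 * p \<in> \<int>"
  shows "0 \<le> T - 2 * p" "T - 2 * p \<le> 3 / 4 * (a + b) ^ 2" "T = 2 * p \<Longrightarrow> a + b = 0"
proof -
  \<comment> \<open>The form of \<open>h\<close> from which its sign can be read off.\<close>
  have h': "4 * ((2 * p - T) * (2 * p + T)) + 3 * (2 * p + T) * (a + b) ^ 2
              + 3 * (2 * p - T) * (a - b) ^ 2 = 0"
    using h by Groebner_Basis.algebra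
  have d: "(a - b) ^ 2 > 0" using ne by simp
  have d2: "(a - b) ^ 2 < 1" using d1 by (simp add: abs_square_less_1)
  have lo: "T \<ge> - 2 * p"
  proof (rule ccontr)
    assume n: "\<not> T \<ge> - 2 * p"
    obtain m where m: "T + 2 * p = of_int m" using int by (rule Ints_cases)
    have "real_of_int m < 0" using n m by linarith
    then have "m \<le> - 1" by linarith
    then have M: "T + 2 * p \<le> - 1" unfolding m by linarith
    define v1 v2 v3 where "v1 = (2 * p - T) * (2 * p + T)" and "v2 = (2 * p + T) * (a + b) ^ 2"
      and "v3 = (2 * p - T) * (a - b) ^ 2"
    \<comment> \<open>In \<open>h'\<close> the three terms are at most - 4 (2p - T), 0 and 3 (2p -
      T), so their sum is negative.\<close>
    have "(2 * p - T) * (a - b) ^ 2 \<le> (2 * p - T) * 1"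
      using M p d2 by (intro mult_left_mono) auto
    then have "v3 \<le> 2 * p - T" by (simp add: v3_def)
    moreover have "v2 \<le> 0"
      unfolding v2_def by (rule mult_nonpos_nonneg) (use M in auto)
    moreover have "(2 * p - T) * (2 * p + T) \<le> (2 * p - T) * (- 1)"
      using M p by (intro mult_left_mono) auto
    then have "v1 \<le> T - 2 * p" by (simp add: v1_def)
    moreover have "4 * v1 + 3 * v2 + 3 * v3 = 0"
      using h' by (simp only: v1_def v2_def v3_def mult.assoc)
    ultimately show False using M p by linarith
  qed
  show hi: "0 \<le> T - 2 * p"
  proof (rule ccontr)
    assume n: "\<not> 0 \<le> T - 2 * p"
    have "3 * (2 * p - T) * (a - b) ^ 2 > 0"
      by (rule mult_pos_pos) (use n d in auto)
    moreover have "3 * (2 * p + T) * (a + b) ^ 2 \<ge> 0"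
      by (rule mult_nonneg_nonneg) (use lo in auto)
    moreover have "(2 * p - T) * (2 * p + T) \<ge> 0"
      by (rule mult_nonneg_nonneg) (use n lo in auto)
    ultimately show False using h' by linarith
  qed
  \<comment> \<open>\<open>h'\<close> regrouped; the factor 2p + T is positive by
    \<open>hi\<close>.\<close>
  have "(2 * p + T) * (3 * (a + b) ^ 2 - 4 * (T - 2 * p)) = 3 * (T - 2 * p) * (a - b) ^ 2"
    using h' by Groebner_Basis.algebra
  also have "\<dots> \<ge> 0" by (rule mult_nonneg_nonneg) (use hi in auto)
  finally show "T - 2 * p \<le> 3 / 4 * (a + b) ^ 2"
    using hi p by (simp add: zero_le_mult_iff)
  show "a + b = 0" if "T = 2 * p"
    using h' p that by simp
qed

section \<open>The resulting Diophantine equations\<close>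

lemma coprime_bezoutI:
  fixes u v x y :: int
  assumes "u * x + v * y = 1"
  shows "coprime x y"
proof (rule coprimeI)
  fix g assume "g dvd x" "g dvd y"
  then have "g dvd u * x + v * y" by (intro dvd_add dvd_mult)
  then show "is_unit g" unfolding assms .
qed

lemma square_dvd_coprime_cube:
  fixes r s t x :: int
  assumes "r ^ 2 * t = s ^ 3 * x ^ 2" and "coprime r s"
  shows "r dvd x"
proof -
  have "r ^ 2 dvd s ^ 3 * x ^ 2" unfolding assms(1)[symmetric] by simp
  then have "r ^ 2 dvd x ^ 2"
    using assms(2) by (simp add: coprime_dvd_mult_right_iff)
  then show ?thesis by simp
qed

lemma int_dvd_neg_bound:
  fixes r x :: int
  assumes "r dvd x" "- (2 * r) < x" "x < 0" "r > 0"
  shows "x = - r"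
proof -
  obtain k where k: "x = r * k" using assms(1) by blast
  have "r * k < r * 0" "r * (- 2) < r * k" using assms k by auto
  then have "k < 0" "- 2 < k" using assms(4) by (simp_all only: mult_less_cancel_left_pos)
  then have "k = - 1" by linarith
  then show ?thesis using k by simp
qed

lemma no_solution_integral:
  fixes p q q' k :: int
  assumes bounds: "- p \<le> q" "q \<le> - 1" "- p \<le> q'" "q' \<le> - 1"
    and k: "k = 1 \<or> k = 2"
    and eq: "k * (3 * p + k) ^ 2 * ((4 * p + k) * (p + k) ^ 2 - 27 * q * q') = 27 * p ^ 3 * (q + q') ^ 2"
  shows False
proof -
  define W where "W = (4 * p + k) * (p + k) ^ 2 - 27 * q * q'"
  have eq': "(3 * p + k) ^ 2 * (k * W) = (3 * p) ^ 3 * (q + q') ^ 2"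
    using eq unfolding W_def by (simp add: power_mult_distrib mult_ac)
  \<comment> \<open>The only candidate multiple is - (3p + k), which lies below the lower bound - 2p
    of q + q'.\<close>
  have no_dvd: "\<not> 3 * p + k dvd q + q'"
  proof
    assume "3 * p + k dvd q + q'"
    then have "q + q' = - (3 * p + k)"
      by (rule int_dvd_neg_bound) (use bounds k in auto)
    then show False using bounds k by auto
  qed
  show False
  proof (cases "coprime (3 * p + k) (3 * p)")
    case True
    then show False using square_dvd_coprime_cube[OF eq'] no_dvd by blast
  next
    case nc: False
    have "k \<noteq> 1"
    proof
      assume "k = 1"
      have "coprime (3 * p + 1) (3 * p)" by (rule coprime_bezoutI[of 1 _ "- 1"]) simp
      then show False using nc \<open>k = 1\<close> by simp
    qed
    then have k2: "k = 2" using k by simp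
    have "even p"
    proof (rule ccontr)
      assume "odd p"
      then obtain m where m: "p = 2 * m + 1" by (rule oddE)
      have "coprime (3 * p + 2) (3 * p)"
        \<comment> \<open>From 1 = 3p - (3m + 1) * 2, with 2 written as (3p + 2) - 3p.\<close>
        by (rule coprime_bezoutI[of "- (3 * m + 1)" _ "3 * m + 2"]) (simp add: m algebra_simps)
      then show False using nc k2 by simp
    qed
    then obtain r where r: "p = 2 * r" by blast
    have r1: "r \<ge> 1" using bounds r by linarith
    have eqr: "(3 * r + 1) ^ 2 * W = (3 * r) ^ 3 * (q + q') ^ 2"
    proof -
      have "8 * ((3 * r + 1) ^ 2 * W) = 8 * ((3 * r) ^ 3 * (q + q') ^ 2)"
        using eq' unfolding k2 r by (simp add: power2_eq_square power3_eq_cube algebra_simps)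
      then show ?thesis by linarith
    qed
    have "3 * r + 1 dvd q + q'"
      by (rule square_dvd_coprime_cube[OF eqr], rule coprime_bezoutI[of 1 _ "- 1"]) simp
    \<comment> \<open>With p = 2r the divisor is halved and this value respects the bound - 4r; it
      is refuted by 4 q q' \<le> (q + q')^2.\<close>
    then have s: "q + q' = - (3 * r + 1)"
      by (rule int_dvd_neg_bound) (use bounds r r1 in auto)
    have "(3 * r + 1) ^ 2 * W = (3 * r + 1) ^ 2 * (3 * r) ^ 3"
      using eqr unfolding s by (simp only: power2_minus mult.commute)
    then have "W = (3 * r) ^ 3" using r1 by auto
    then have 1: "27 * (q * q') = 5 * r ^ 3 + 72 * r ^ 2 + 48 * r + 8"
      unfolding W_def k2 r by (simp add: power2_eq_square power3_eq_cube algebra_simps)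
    have "4 * (q * q') = (q + q') ^ 2 - (q - q') ^ 2"
      by (simp add: power2_eq_square algebra_simps)
    also have "\<dots> \<le> (q + q') ^ 2" by simp
    also have "\<dots> = (3 * r + 1) ^ 2" by (simp only: s power2_minus)
    also have "\<dots> = 9 * r ^ 2 + 6 * r + 1" by (simp add: power2_eq_square algebra_simps)
    finally have "108 * (q * q') \<le> 243 * r ^ 2 + 162 * r + 27" by simp
    moreover have "r ^ 3 \<ge> 0" "r ^ 2 \<ge> 0" using r1 by auto
    ultimately show False using 1 r1 by linarith
  qed
qed

text \<open>The case p = c - 1/3, k = 1/3 with denominators cleared: 9c - 2 = 3 (3p + k), 3c - 1 =
  3p, and 27d + 9c - 2 = 27q.\<close>

lemma no_solution_third:
  fixes c d e :: int
  assumes bounds: "- (c - 1) \<le> d" "d \<le> - 1" "- (c - 1) \<le> e" "e \<le> - 1"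
    and eq: "(9 * c - 2) ^ 2 * ((12 * c - 3) * (9 * c ^ 2) - (27 * d + 9 * c - 2) * (27 * e + 9 * c - 2))
               = (3 * c - 1) ^ 3 * (27 * (d + e) + 2 * (9 * c - 2)) ^ 2"
  shows False
proof -
  have cop: "coprime (9 * c - 2) (3 * c - 1)"
    by (rule coprime_bezoutI[of 1 _ "- 3"]) simp
  have cop27: "coprime (9 * c - 2) 27"
    \<comment> \<open>Use (9c - 2)(9c + 2) = 81 c^2 - 4 and 7 * 4 = 27 + 1.\<close>
    by (rule coprime_bezoutI[of "- 7 * (9 * c + 2)" _ "21 * c ^ 2 - 1"])
       (simp add: algebra_simps power2_eq_square)
  have "9 * c - 2 dvd 27 * (d + e) + 2 * (9 * c - 2)"
    using square_dvd_coprime_cube[OF eq cop] .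
  then have "9 * c - 2 dvd 27 * (d + e) + 2 * (9 * c - 2) - 2 * (9 * c - 2)"
    by (rule dvd_diff) (rule dvd_triv_right)
  also have "\<dots> = 27 * (d + e)" by simp
  finally have "9 * c - 2 dvd 27 * (d + e)" .
  then have "9 * c - 2 dvd d + e"
    using coprime_dvd_mult_right_iff[OF cop27] by blast
  then have "d + e = - (9 * c - 2)"
    by (rule int_dvd_neg_bound) (use bounds in auto)
  then show False using bounds by linarith
qed

section \<open>The cases b = 0 and b = - 1\<close>

lemma I3ntr_irrational:
  assumes "x \<in> I3ntr b c"
  shows "x \<notin> \<rat>"
proof
  assume "x \<in> \<rat>"
  then have "x \<in> \<int>"
    using assms unfolding I3ntr_def by (auto intro: monic_cubic_rational_root_int)
  then obtain n where "x = of_int n" by (rule Ints_cases)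
  then show False using assms unfolding I3ntr_def by auto
qed

lemma span_imp_eq_0:
  fixes c :: int
  assumes c: "c \<ge> 1" and A: "\<alpha> \<in> I3ntr 0 c" and B: "\<beta> \<in> I3ntr 0 c" and span: "\<beta> \<in> rat_span \<alpha>"
  shows "\<alpha> = \<beta>"
proof (rule ccontr)
  assume ne: "\<alpha> \<noteq> \<beta>"
  obtain d where d: "- c \<le> d" "d \<le> - 1" "\<alpha> ^ 3 + of_int c * \<alpha> + of_int d = 0"
    using A unfolding I3ntr_def by auto
  obtain e where e: "- c \<le> e" "e \<le> - 1" "\<beta> ^ 3 + of_int c * \<beta> + of_int e = 0"
    using B unfolding I3ntr_def by auto
  have r: "0 < \<alpha>" "\<alpha> < 1" "0 < \<beta>" "\<beta> < 1"
    using A B unfolding I3ntr_def by auto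
  interpret A: irrational_cubic \<alpha> "of_int c" "of_int d"
    by unfold_locales (use d c I3ntr_irrational[OF A] in auto)
  have "irrational_cubic \<beta> (of_int c) (of_int e)"
    by unfold_locales (use e c I3ntr_irrational[OF B] in auto)
  then obtain T where T: "T \<in> \<rat>"
    "T ^ 2 - 3 * \<alpha> * \<beta> * T - 3 * of_int c * (\<alpha> ^ 2 + \<beta> ^ 2) - 4 * (of_int c) ^ 2 = 0"
    using A.trace_quadratic[OF _ span] by blast
  note sextic = trace_sextic[OF T(2) d(3) e(3)]
  have "T \<in> \<int>"
    by (rule monic_sextic_rational_root_int[of T 0 "- 6 * c ^ 2" "- 27 * d * e" "9 * c ^ 4"
          "81 * c ^ 2 * d * e" "- 4 * c ^ 6 - 27 * c ^ 3 * (d ^ 2 + e ^ 2)"])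
       (use sextic T(1) in \<open>simp_all add: algebra_simps eval_nat_numeral\<close>)
  then obtain t where t: "T = of_int t" by (rule Ints_cases)
  define k where "k = t - 2 * c"
  have Tk: "T = of_int (2 * c + k)" unfolding t k_def by simp
  have "T + 2 * of_int c \<in> \<int>" unfolding t by simp
  note bd = trace_bounds[OF T(2) A.pos ne _ this]
  have ab: "\<bar>\<alpha> - \<beta>\<bar> < 1" using r by linarith
  have "(\<alpha> + \<beta>) ^ 2 < 2 ^ 2" by (rule power_strict_mono) (use r in auto)
  then have "real_of_int k < 3" using bd(2)[OF ab] unfolding Tk by simp
  moreover have "real_of_int k \<ge> 0" using bd(1)[OF ab] unfolding Tk by simp
  moreover have "k \<noteq> 0" using bd(3)[OF ab] r unfolding Tk by auto
  ultimately have k: "k = 1 \<or> k = 2" by linarith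
  \<comment> \<open>With p = c and T = 2p + k: T^2 - 4p^2 = k (4p + k), T^2 - p^2 = (p + k)(3p + k)
    and T^3 - 3p^2 T = 2p^3 + k (3p + k)^2.\<close>
  have "real_of_int (k * (3 * c + k) ^ 2 * ((4 * c + k) * (c + k) ^ 2 - 27 * d * e))
     = real_of_int (27 * c ^ 3 * (d + e) ^ 2)"
    using sextic unfolding Tk by simp Groebner_Basis.algebra
  then have "k * (3 * c + k) ^ 2 * ((4 * c + k) * (c + k) ^ 2 - 27 * d * e) = 27 * c ^ 3 * (d + e) ^ 2"
    by (simp only: of_int_eq_iff)
  then show False
    using no_solution_integral d(1,2) e(1,2) k by blast
qed

lemma span_imp_eq_minus_1:
  fixes c :: int
  assumes c: "c \<ge> 2" and A: "\<alpha> \<in> I3ntr (- 1) c" and B: "\<beta> \<in> I3ntr (- 1) c"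
    and span: "\<beta> \<in> rat_span \<alpha>"
  shows "\<alpha> = \<beta>"
proof (rule ccontr)
  assume ne: "\<alpha> \<noteq> \<beta>"
  obtain d where d: "- (c - 1) \<le> d" "d \<le> - 1" "\<alpha> ^ 3 - \<alpha> ^ 2 + of_int c * \<alpha> + of_int d = 0"
    using A unfolding I3ntr_def by auto
  obtain e where e: "- (c - 1) \<le> e" "e \<le> - 1" "\<beta> ^ 3 - \<beta> ^ 2 + of_int c * \<beta> + of_int e = 0"
    using B unfolding I3ntr_def by auto
  have r: "0 < \<alpha>" "\<alpha> < 1" "0 < \<beta>" "\<beta> < 1"
    using A B unfolding I3ntr_def by auto
  define u :: real where "u = 1 / 3"
  have u: "3 * u = 1" "u \<in> \<rat>" by (simp_all add: u_def)
  define p where "p = real_of_int c - u"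
  define a b where "a = \<alpha> - u" and "b = \<beta> - u"
  define q q' where "q = real_of_int d + of_int c * u - 2 * u ^ 3"
    and "q' = real_of_int e + of_int c * u - 2 * u ^ 3"
  have roots: "a ^ 3 + p * a + q = 0" "b ^ 3 + p * b + q' = 0"
    using d(3) e(3) u(1) unfolding a_def b_def p_def q_def q'_def
    by Groebner_Basis.algebra+
  have rat: "p \<in> \<rat>" "q \<in> \<rat>" "q' \<in> \<rat>"
    unfolding p_def q_def q'_def using u by auto
  have p: "p > 0" unfolding p_def u_def using c by linarith
  have irr: "a \<notin> \<rat>" "b \<notin> \<rat>"
    using I3ntr_irrational[OF A] I3ntr_irrational[OF B]
      Rats_add[of a u] Rats_add[of b u] u
    unfolding a_def b_def by auto
  interpret A: irrational_cubic a p q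
    by unfold_locales (use roots rat p irr in auto)
  have irrB: "irrational_cubic b p q'"
    by unfold_locales (use roots rat p irr in auto)
  have "\<beta> \<in> rat_span a"
    using rat_span_affine[OF span, of 1 "- u"] u by (simp add: a_def)
  then have "b \<in> rat_span a"
    using rat_span_add[of \<beta> a "- u"] rat_span_Rats[of "- u" a] u by (simp add: b_def)
  then obtain T where T: "T \<in> \<rat>"
    "T ^ 2 - 3 * a * b * T - 3 * p * (a ^ 2 + b ^ 2) - 4 * p ^ 2 = 0"
    using A.trace_quadratic[OF irrB] by blast
  note sextic = trace_sextic[OF T(2) roots]
  \<comment> \<open>The trace of (a + u)(b + u) is T + 3 u^2 = T + u, as \<open>a\<close> and
    \<open>b\<close> have trace 0.\<close>
  define S where "S = T + u"
  have ST: "T = S - u" by (simp add: S_def)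
  \<comment> \<open>The sextic times 3^6; expanding it in S and dividing by 3^6 again gives the
    integer coefficients below.\<close>
  have scaled: "((3 * T) ^ 2 - 4 * (3 * p) ^ 2) * ((3 * T) ^ 2 - (3 * p) ^ 2) ^ 2
      - (3 * p) ^ 3 * ((27 * q) ^ 2 + (27 * q') ^ 2)
      - (27 * q) * (27 * q') * ((3 * T) ^ 3 - 3 * (3 * p) ^ 2 * (3 * T)) = 0"
    using sextic by Groebner_Basis.algebra
  have ints: "3 * T = 3 * S - 1" "3 * p = 3 * of_int c - 1"
    "27 * q = 27 * of_int d + 9 * of_int c - 2" "27 * q' = 27 * of_int e + 9 * of_int c - 2"
    unfolding ST p_def q_def q'_def u_def by (simp_all add: power3_eq_cube)
  have "S \<in> \<int>"
  proof (rule monic_sextic_rational_root_int[of S "- 2" "- 6 * c ^ 2 + 4 * c + 1"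
        "- 27 * d * e - 9 * c * e - 9 * c * d + 5 * c ^ 2 + 2 * e + 2 * d - 4 * c"
        "9 * c ^ 4 + 27 * d * e - 12 * c ^ 3 + 9 * c * e + 9 * c * d + 5 * c ^ 2 - 2 * e - 2 * d"
        "81 * c ^ 2 * d * e + 27 * c ^ 3 * e + 27 * c ^ 3 * d - 54 * c * d * e + 3 * c ^ 4
           - 24 * c ^ 2 * e - 24 * c ^ 2 * d - 2 * c ^ 3 + 4 * c * e + 4 * c * d"
        "- 27 * c ^ 3 * e ^ 2 - 27 * c ^ 3 * d ^ 2 - 4 * c ^ 6 - 18 * c ^ 4 * e - 18 * c ^ 4 * d
           + 27 * c ^ 2 * e ^ 2 - 27 * c ^ 2 * d * e + 27 * c ^ 2 * d ^ 2 + 2 * c ^ 5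
           + 13 * c ^ 3 * e + 13 * c ^ 3 * d - 9 * c * e ^ 2 + 18 * c * d * e - 9 * c * d ^ 2
           - 2 * c ^ 2 * e - 2 * c ^ 2 * d + e ^ 2 - 2 * d * e + d ^ 2"], goal_cases)
    case 1
    show ?case
      using scaled unfolding ints by simp Groebner_Basis.algebra
  next
    case 2
    show ?case using T(1) u by (simp add: S_def)
  qed
  then obtain n where n: "S = of_int n" by (rule Ints_cases)
  have "T + 2 * p = of_int (n + 2 * c - 1)" unfolding ST n p_def u_def by simp
  then have "T + 2 * p \<in> \<int>" by simp
  note bd = trace_bounds[OF T(2) p _ _ this]
  have ab: "a \<noteq> b" "\<bar>a - b\<bar> < 1" using r ne unfolding a_def b_def by auto
  \<comment> \<open>a + b lies between - 2/3 and 4/3, so T - 2p = n - 2c + 1/3 is below 3/4 * 16/9 =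
    4/3.\<close>
  have "\<bar>a + b\<bar> < 4 / 3" using r unfolding a_def b_def u_def by linarith
  then have "\<bar>a + b\<bar> ^ 2 < (4 / 3) ^ 2" by (rule power_strict_mono) auto
  then have "T - 2 * p < 4 / 3" using bd(2)[OF ab] by (simp add: power2_eq_square)
  then have "real_of_int (n - 2 * c) < 1" unfolding ST n p_def u_def by simp
  moreover have "real_of_int (n - 2 * c) \<ge> - 1 / 3" using bd(1)[OF ab] unfolding ST n p_def u_def by simp
  ultimately have "n - 2 * c = 0" by linarith
  then have S: "S = 2 * of_int c" unfolding n by simp
  have "real_of_int ((9 * c - 2) ^ 2 * ((12 * c - 3) * (9 * c ^ 2)
        - (27 * d + 9 * c - 2) * (27 * e + 9 * c - 2)))
     = real_of_int ((3 * c - 1) ^ 3 * (27 * (d + e) + 2 * (9 * c - 2)) ^ 2)"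
    using scaled unfolding ints S by simp Groebner_Basis.algebra
  then have "(9 * c - 2) ^ 2 * ((12 * c - 3) * (9 * c ^ 2)
        - (27 * d + 9 * c - 2) * (27 * e + 9 * c - 2))
     = (3 * c - 1) ^ 3 * (27 * (d + e) + 2 * (9 * c - 2)) ^ 2"
    by (simp only: of_int_eq_iff)
  then show False
    using no_solution_third d(1,2) e(1,2) by blast
qed

section \<open>Reflection and conclusion\<close>

lemma I3ntr_reflect:
  assumes "x \<in> I3ntr b c"
  shows "1 - x \<in> I3ntr (- 3 - b) (3 + 2 * b + c)"
proof -
  obtain d where d: "- (b + c) \<le> d" "d \<le> - 1"
    "x ^ 3 + of_int b * x ^ 2 + of_int c * x + of_int d = 0" and x: "0 < x" "x < 1"
    using assms unfolding I3ntr_def by auto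
  have "(1 - x) ^ 3 + of_int (- 3 - b) * (1 - x) ^ 2 + of_int (3 + 2 * b + c) * (1 - x)
          + of_int (- 1 - b - c - d)
      = - (x ^ 3 + of_int b * x ^ 2 + of_int c * x + of_int d)"
    by (simp add: power2_eq_square power3_eq_cube algebra_simps)
  then show ?thesis
    \<comment> \<open>The new constant term is - f(1) for the old cubic f; b + c is unchanged, and
      the admissible range of d is mapped to itself.\<close>
    using d x unfolding I3ntr_def by (auto intro!: exI[of _ "- 1 - b - c - d"])
qed

lemma rat_span_reflect: "u \<in> rat_span a \<Longrightarrow> 1 - u \<in> rat_span (1 - a)"
  using rat_span_affine[of u a "- 1" 1] rat_span_uminus[of u "1 - a"]
    rat_span_add[of 1 "1 - a" "- u"] rat_span_Rats[of 1 "1 - a"]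
  by simp

text \<open>Stronger than distinctness of the fields: no element lies in the field generated by
  another one.\<close>

lemma span_imp_eq:
  fixes b c :: int
  assumes bc: "- 3 \<le> b" "b \<le> 0" "c \<ge> - b + 1"
    and A: "\<alpha> \<in> I3ntr b c" and B: "\<beta> \<in> I3ntr b c" and span: "\<beta> \<in> rat_span \<alpha>"
  shows "\<alpha> = \<beta>"
proof -
  consider "b = 0" | "b = - 1" | "b = - 2" | "b = - 3" using bc by linarith
  then show ?thesis
  proof cases
    case 1
    then show ?thesis using span_imp_eq_0[of c] bc A B span by simp
  next
    case 2
    then show ?thesis using span_imp_eq_minus_1[of c] bc A B span by simp
  next
    case 3
    then have "1 - \<alpha> = 1 - \<beta>"
      using span_imp_eq_minus_1[of "c - 1"] bc I3ntr_reflect[OF A] I3ntr_reflect[OF B]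
        rat_span_reflect[OF span] by simp
    then show ?thesis by simp
  next
    case 4
    then have "1 - \<alpha> = 1 - \<beta>"
      using span_imp_eq_0[of "c - 3"] bc I3ntr_reflect[OF A] I3ntr_reflect[OF B]
        rat_span_reflect[OF span] by simp
    then show ?thesis by simp
  qed
qed

lemma I3ntr_Q_adjoin_rat_span:
  assumes "\<alpha> \<in> I3ntr b c" and "complex_of_real \<beta> \<in> Q_adjoin (complex_of_real \<alpha>)"
  shows "\<beta> \<in> rat_span \<alpha>"
proof -
  obtain d where d: "\<alpha> ^ 3 + of_int b * \<alpha> ^ 2 + of_int c * \<alpha> + of_int d = 0"
    using assms(1) unfolding I3ntr_def by auto
  define s where "s = real_of_int b / 3"
  have s: "s \<in> \<rat>" and b: "of_int b = 3 * s" unfolding s_def by auto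
  interpret depressed_cubic "\<alpha> + s" "of_int c - 3 * s ^ 2" "of_int d - s * of_int c + 2 * s ^ 3"
  proof
    show "(\<alpha> + s) ^ 3 + (of_int c - 3 * s ^ 2) * (\<alpha> + s) + (of_int d - s * of_int c + 2 * s ^ 3) = 0"
      using d unfolding b by Groebner_Basis.algebra
  qed (use s in auto)
  have "\<alpha> \<in> rat_span (\<alpha> + s)"
    by (rule rat_spanI[of "- s" 1 0]) (use s in auto)
  then have "complex_of_real \<beta> \<in> complex_of_real ` rat_span (\<alpha> + s)"
    using assms(2) by (rule Q_adjoin_subset_rat_span)
  then have "\<beta> \<in> rat_span (\<alpha> + s)" by auto
  then show ?thesis
    using rat_span_affine[of \<beta> "\<alpha> + s" 1 "- s"] s by simp
qed

theorem theorem11: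
  fixes b c :: int
  assumes "- 3 \<le> b" and "b \<le> 0" and "c \<ge> - b + 1"
  shows "\<forall>\<alpha> \<in> I3ntr b c. \<forall>\<beta> \<in> I3ntr b c. \<alpha> \<noteq> \<beta> \<longrightarrow>
           Q_adjoin (complex_of_real \<alpha>) \<noteq> Q_adjoin (complex_of_real \<beta>)"
proof (intro ballI impI notI)
  fix \<alpha> \<beta>
  assume A: "\<alpha> \<in> I3ntr b c" and B: "\<beta> \<in> I3ntr b c" and ne: "\<alpha> \<noteq> \<beta>"
    and eq: "Q_adjoin (complex_of_real \<alpha>) = Q_adjoin (complex_of_real \<beta>)"
  have "complex_of_real \<beta> \<in> Q_adjoin (complex_of_real \<beta>)"
    unfolding Q_adjoin_def by (rule generate_field.incl) simp
  then have "\<beta> \<in> rat_span \<alpha>"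
    using I3ntr_Q_adjoin_rat_span[OF A] eq by simp
  then show False using span_imp_eq[OF assms A B] ne by blast
qed

end
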